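(* Let $X_1,X_2,\dots$ be a sequence of random variables on a common probability space, and let $\alpha_1,\alpha_2,\dots\ge 0$, $r>0$ and $K>0$ be fixed real numbers. Assume that for each $m\ge 1$ and every $\varepsilon>0$ $$\mathbb{P}\Big(\max_{1\le l\le m}|S_l|\ge\varepsilon\Big)\le\frac{K}{\varepsilon^r}\sum_{l=1}^m\alpha_l .$$ Let $b_1,b_2,\dots$ be a non-decreasing unbounded sequence of positive numbers such that $$\sum_{l=1}^\infty\frac{\alpha_l}{b_l^r}<\infty .$$ Then $\lim_{n\to\infty}S_n/b_n=0$ almost surely. Moreover, for an arbitrary number $\delta$ with $0<\delta<1$, putting $$\nu_k=\sum_{l=k}^\infty\frac{\alpha_l}{b_l^r},\qquad \beta_n=\max_{1\le k\le n}b_k\,\nu_k^{\delta/r},$$ we have $$\frac{S_n}{b_n}=\mathrm{O}\left(\frac{\beta_n}{b_n}\right)\quad\text{almost surely.}$$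
   Context: $S_n=X_1+\dots+X_n$ denotes the partial sums. The relation $S_n/b_n=\mathrm{O}(\beta_n/b_n)$ almost surely means that, with probability one, there is a finite (random) constant $c$ such that $|S_n/b_n|\le c\,\beta_n/b_n$ for all sufficiently large $n$. No assumption is made on the dependence structure of the random variables. *)

theory Defs
  imports "HOL-Probability.Probability"
begin

(* Sequences are indexed from 1 as in the source; index 0 is immaterial. *)

definition partial_sum :: "(nat \<Rightarrow> 'a \<Rightarrow> real) \<Rightarrow> nat \<Rightarrow> 'a \<Rightarrow> real" where
  "partial_sum X n \<omega> = (\<Sum>i=1..n. X i \<omega>)"

definition tail_nu :: "(nat \<Rightarrow> real) \<Rightarrow> (nat \<Rightarrow> real) \<Rightarrow> real \<Rightarrow> nat \<Rightarrow> real" where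
  "tail_nu \<alpha> b r k = (\<Sum>l. \<alpha> (l + k) / b (l + k) powr r)"

(* If tail_nu vanishes, the power is 0, because 0 powr x = 0 in the library. *)
definition max_beta ::
  "(nat \<Rightarrow> real) \<Rightarrow> (nat \<Rightarrow> real) \<Rightarrow> real \<Rightarrow> real \<Rightarrow> nat \<Rightarrow> real" where
  "max_beta \<alpha> b r \<delta> n = Max ((\<lambda>k. b k * tail_nu \<alpha> b r k powr (\<delta> / r)) ` {1..n})"

(* The constant c is chosen after \<omega>, i.e. it is random. *)
definition as_bigo :: "'a measure \<Rightarrow> (nat \<Rightarrow> 'a \<Rightarrow> real) \<Rightarrow> (nat \<Rightarrow> real) \<Rightarrow> bool" where
  "as_bigo M f g \<longleftrightarrow> (AE \<omega> in M. \<exists>c. \<forall>\<^sub>F n in sequentially. \<bar>f n \<omega>\<bar> \<le> c * g n)"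

end

theory Submission
  imports Defs
begin

text \<open>
  Cut the indices into blocks on which \<open>w\<^sub>l\<^sup>r\<close> varies by at most a factor 2, apply the maximal
  inequality to each block and sum the resulting geometric series. This gives a Hajek--Renyi
  inequality for every positive non-decreasing weight \<open>w\<close>; letting \<open>\<epsilon> \<rightarrow> \<infinity>\<close>,
  \<open>sup |S\<^sub>l| / w\<^sub>l\<close> is finite almost surely as soon as \<open>\<Sum> \<alpha>\<^sub>l / w\<^sub>l\<^sup>r\<close> converges.
  The weight \<open>\<beta>\<close> qualifies because \<open>\<alpha>\<^sub>l / \<beta>\<^sub>l\<^sup>r \<le> (\<nu>\<^sub>l - \<nu>\<^sub>l\<^sub>+\<^sub>1) / \<nu>\<^sub>l\<^sup>\<delta>\<close>, which is dominated by the
  telescoping differences of \<open>\<nu>\<^sub>l\<close> to the power \<open>1 - \<delta>\<close>. Finally \<open>\<beta>\<^sub>n / b\<^sub>n \<rightarrow> 0\<close>, so the rate also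
  yields the strong law.
\<close>

section \<open>Dyadic blocks and geometric sums\<close>

lemma dyadic_block:
  fixes c y :: real
  assumes "c \<le> y" "y < 2 ^ N * c"
  shows "\<exists>i<N. 2 ^ i * c \<le> y \<and> y < 2 ^ Suc i * c"
  using assms(2)
proof (induction N)
  case 0
  then show ?case using assms(1) by simp
next
  case (Suc N)
  then show ?case
    by (cases "y < 2 ^ N * c") (auto simp: not_less less_Suc_eq)
qed

lemma sum_half_powers_tail_le:
  "(\<Sum>i=j..<N. (1 / 2 :: real) ^ i) \<le> 2 * (1 / 2) ^ j"
proof (cases "j \<le> N")
  case True
  then have "(\<Sum>i=j..<N. (1 / 2 :: real) ^ i) = 2 * (1 / 2) ^ j - 2 * (1 / 2) ^ N"
    by (induction N rule: dec_induct) auto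
  then show ?thesis by simp
qed simp

text \<open>If y lies in block j, only the indices i \<ge> j contribute, so the sum is at most the
  geometric tail 2 (1/2)^j / c, and \<open>y < 2 ^ Suc j * c\<close> turns this into 4 / y. In
  \<open>hajek_renyi\<close> it bounds the total weight that a single \<alpha> l collects from all
  blocks.\<close>

lemma sum_dyadic_indicator_le:
  fixes c y :: real
  assumes "0 < c" "c \<le> y" "y < 2 ^ N * c"
  shows "(\<Sum>i<N. if y < 2 ^ Suc i * c then (1 / 2) ^ i / c else 0) \<le> 4 / y"
proof -
  obtain j where j: "2 ^ j * c \<le> y" "y < 2 ^ Suc j * c"
    using dyadic_block[OF assms(2,3)] by blast
  have ge: "j \<le> i" if "y < 2 ^ Suc i * c" for i
  proof (rule ccontr)
    assume "\<not> j \<le> i"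
    then have "(2::real) ^ Suc i \<le> 2 ^ j" by (intro power_increasing) auto
    then have "2 ^ Suc i * c \<le> 2 ^ j * c" using assms(1) by (intro mult_right_mono) auto
    then show False using that j(1) by linarith
  qed
  have "(\<Sum>i<N. if y < 2 ^ Suc i * c then (1 / 2) ^ i / c else 0)
      \<le> (\<Sum>i<N. if i \<in> {j..<N} then (1 / 2) ^ i / c else 0)"
    using ge assms(1) by (intro sum_mono) auto
  also have "\<dots> = (\<Sum>i=j..<N. (1 / 2) ^ i / c)"
    by (subst sum.inter_restrict[symmetric]) (auto intro: sum.cong)
  also have "\<dots> \<le> 2 * (1 / 2) ^ j / c"
    using sum_half_powers_tail_le[of j N] assms(1)
    by (simp add: sum_divide_distrib[symmetric] divide_right_mono)
  also have "\<dots> \<le> 4 / y"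
    using j(2) assms by (simp add: field_simps power_divide)
  finally show ?thesis .
qed

section \<open>Weighted maximal inequality and almost sure boundedness\<close>

text \<open>On each dyadic block of w^r the weight is replaced by its value at the lower edge of the
  block. Since the maximal inequality speaks only of initial segments, each block is enlarged to all
  indices up to its end. A given \<alpha> l is then counted again in every later block, but with
  geometrically decaying factors, and the total loss is the factor 4.\<close>

lemma (in finite_measure) hajek_renyi:
  fixes S :: "nat \<Rightarrow> 'a \<Rightarrow> real" and \<alpha> w :: "nat \<Rightarrow> real" and r K :: real
  assumes S [measurable]: "\<And>n. n \<ge> 1 \<Longrightarrow> S n \<in> borel_measurable M"
    and \<alpha>: "\<And>n. n \<ge> 1 \<Longrightarrow> \<alpha> n \<ge> 0"
    and r: "r > 0" and K: "K \<ge> 0"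
    and maximal: "\<And>m \<epsilon>. m \<ge> 1 \<Longrightarrow> \<epsilon> > 0 \<Longrightarrow>
      measure M {\<omega> \<in> space M. \<exists>l\<in>{1..m}. \<bar>S l \<omega>\<bar> \<ge> \<epsilon>} \<le> K / \<epsilon> powr r * (\<Sum>l=1..m. \<alpha> l)"
    and w_pos: "\<And>n. n \<ge> 1 \<Longrightarrow> w n > 0"
    and w_mono: "mono_on {1..} w"
    and m: "m \<ge> 1" and \<epsilon>: "\<epsilon> > 0"
  shows "measure M {\<omega> \<in> space M. \<exists>l\<in>{1..m}. \<bar>S l \<omega>\<bar> \<ge> \<epsilon> * w l}
    \<le> 4 * K / \<epsilon> powr r * (\<Sum>l=1..m. \<alpha> l / w l powr r)"
proof -
  define W where "W l = w l powr r" for l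
  have W_pos: "W l > 0" if "l \<ge> 1" for l
    using w_pos[OF that] by (simp add: W_def)
  have W_mono: "W k \<le> W l" if "1 \<le> k" "k \<le> l" for k l
    unfolding W_def using that r w_pos[of k] mono_onD[OF w_mono, of k l]
    by (intro powr_mono2) auto
  \<comment> \<open>N blocks are enough to reach the index m.\<close>
  obtain N where N: "W m < 2 ^ N * W 1"
    using real_arch_pow[of 2 "W m / W 1"] W_pos[of 1] by (auto simp: divide_less_eq)
  \<comment> \<open>\<open>J i\<close> has no lower cut-off: it is block i together with all earlier
    ones, hence an initial segment to which \<open>maximal\<close> applies.\<close>
  define J where "J i = {l \<in> {1..m}. W l < 2 ^ Suc i * W 1}" for i
  have J_eq: "J i = {1..Max (J i)} \<and> Max (J i) \<ge> 1" for i
  proof -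
    have fin: "finite (J i)" by (simp add: J_def)
    have J_ge: "1 \<le> l" if "l \<in> J i" for l using that by (simp add: J_def)
    have "1 * W 1 < 2 ^ Suc i * W 1"
      using W_pos[of 1] one_less_power[of "2::real" "Suc i"]
      by (intro mult_strict_right_mono) simp_all
    then have one: "1 \<in> J i"
      using m by (simp add: J_def)
    then have Max: "Max (J i) \<in> J i" using fin by (intro Max_in) auto
    have "l \<in> J i" if "1 \<le> l" "l \<le> Max (J i)" for l
      using that Max W_mono[of l "Max (J i)"] by (auto simp: J_def)
    then have "{1..Max (J i)} \<subseteq> J i" by (meson atLeastAtMost_iff subsetI)
    moreover have "J i \<subseteq> {1..Max (J i)}"
      by (intro subsetI) (simp only: atLeastAtMost_iff J_ge Max_ge[OF fin])
    ultimately have "J i = {1..Max (J i)}" by (rule equalityI[rotated])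
    then show ?thesis using J_ge[OF Max] by blast
  qed
  \<comment> \<open>This is \<epsilon> times the lower edge of block i, taken back from the scale of
    w^r to that of w; hence \<open>\<tau> i \<le> \<epsilon> * w l\<close> for every l in block
    i.\<close>
  define \<tau> where "\<tau> i = \<epsilon> * (2 ^ i * W 1) powr (1 / r)" for i :: nat
  have \<tau>_pos: "\<tau> i > 0" for i using \<epsilon> W_pos[of 1] by (simp add: \<tau>_def)
  have \<tau>_powr: "\<tau> i powr r = \<epsilon> powr r * (2 ^ i * W 1)" for i
    using \<epsilon> r W_pos[of 1] by (simp add: \<tau>_def powr_mult powr_powr)
  define F where "F i = {\<omega> \<in> space M. \<exists>l\<in>J i. \<bar>S l \<omega>\<bar> \<ge> \<tau> i}" for i
  have F_sets: "F i \<in> sets M" for i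
  proof -
    have [measurable]: "S l \<in> borel_measurable M" if "l \<in> J i" for l
      using that by (auto simp: J_def)
    have "finite (J i)" by (simp add: J_def)
    then show ?thesis unfolding F_def by measurable
  qed
  have F_le: "measure M (F i) \<le> K / \<epsilon> powr r * (\<Sum>l=1..m. if W l < 2 ^ Suc i * W 1
      then \<alpha> l * ((1 / 2) ^ i / W 1) else 0)" for i
  proof -
    have "measure M (F i) \<le> K / \<tau> i powr r * sum \<alpha> (J i)"
      using maximal[of "Max (J i)" "\<tau> i"] J_eq[of i] \<tau>_pos[of i] unfolding F_def by metis
    also have "\<dots> = K / \<epsilon> powr r * (\<Sum>l\<in>J i. \<alpha> l * ((1 / 2) ^ i / W 1))"
      by (simp add: \<tau>_powr sum_distrib_right[symmetric] sum_divide_distrib[symmetric] power_divide)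
    \<comment> \<open>Summing over the fixed range 1..m with an indicator prepares the interchange
      of the sums over i and l.\<close>
    finally show ?thesis
      by (simp only: J_def sum.inter_filter[OF finite_atLeastAtMost])
  qed
  have cover: "{\<omega> \<in> space M. \<exists>l\<in>{1..m}. \<bar>S l \<omega>\<bar> \<ge> \<epsilon> * w l} \<subseteq> (\<Union>i<N. F i)"
  proof safe
    fix \<omega> l
    assume \<omega>: "\<omega> \<in> space M" and l: "l \<in> {1..m}" and ge: "\<epsilon> * w l \<le> \<bar>S l \<omega>\<bar>"
    have "W 1 \<le> W l" "W l < 2 ^ N * W 1"
      using W_mono[of 1 l] W_mono[of l m] l N by auto
    then obtain i where i: "i < N" "2 ^ i * W 1 \<le> W l" "W l < 2 ^ Suc i * W 1"
      using dyadic_block by blast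
    have "(2 ^ i * W 1) powr (1 / r) \<le> W l powr (1 / r)"
      using i r W_pos[of 1] by (intro powr_mono2) auto
    also have "\<dots> = w l"
      using r w_pos[of l] l by (simp add: W_def powr_powr)
    finally have "\<tau> i \<le> \<epsilon> * w l" using \<epsilon> by (simp add: \<tau>_def)
    then have "\<omega> \<in> F i"
      using \<omega> l ge i by (auto simp: F_def J_def intro!: bexI[of _ l])
    then show "\<omega> \<in> (\<Union>i<N. F i)" using i(1) by blast
  qed
  have "measure M {\<omega> \<in> space M. \<exists>l\<in>{1..m}. \<bar>S l \<omega>\<bar> \<ge> \<epsilon> * w l} \<le> measure M (\<Union>i<N. F i)"
    using F_sets cover by (intro finite_measure_mono) auto
  also have "\<dots> \<le> (\<Sum>i<N. measure M (F i))"
    using F_sets by (intro finite_measure_subadditive_finite) auto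
  also have "\<dots> \<le> (\<Sum>i<N. K / \<epsilon> powr r * (\<Sum>l=1..m. if W l < 2 ^ Suc i * W 1
      then \<alpha> l * ((1 / 2) ^ i / W 1) else 0))"
    by (intro sum_mono F_le)
  \<comment> \<open>After the interchange the inner sum runs over the blocks for a fixed l, which is
    the form of \<open>sum_dyadic_indicator_le\<close>.\<close>
  also have "\<dots> = K / \<epsilon> powr r * (\<Sum>l=1..m. \<alpha> l * (\<Sum>i<N. if W l < 2 ^ Suc i * W 1
      then (1 / 2) ^ i / W 1 else 0))"
    unfolding sum_distrib_left[symmetric]
    by (subst sum.swap) (auto simp: sum_distrib_left intro!: sum.cong)
  also have "\<dots> \<le> K / \<epsilon> powr r * (\<Sum>l=1..m. \<alpha> l * (4 / W l))"
  proof (intro mult_left_mono sum_mono)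
    fix l assume l: "l \<in> {1..m}"
    show "(\<Sum>i<N. if W l < 2 ^ Suc i * W 1 then (1 / 2) ^ i / W 1 else 0) \<le> 4 / W l"
      using W_mono[of 1 l] W_mono[of l m] l N W_pos[of 1]
      by (intro sum_dyadic_indicator_le) auto
  qed (use \<alpha> K \<epsilon> in auto)
  also have "\<dots> = 4 * K / \<epsilon> powr r * (\<Sum>l=1..m. \<alpha> l / w l powr r)"
    by (simp add: W_def sum_distrib_left mult_ac)
  finally show ?thesis .
qed

text \<open>The bound of \<open>hajek_renyi\<close> is uniform in m once the weighted sum is
  replaced by the full series. Continuity from below extends it to the whole sequence, and it tends
  to 0 as the level grows, so almost surely some level is never reached.\<close>

lemma (in finite_measure) AE_bounded_ratio:
  fixes S :: "nat \<Rightarrow> 'a \<Rightarrow> real" and \<alpha> w :: "nat \<Rightarrow> real" and r K :: real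
  assumes S [measurable]: "\<And>n. n \<ge> 1 \<Longrightarrow> S n \<in> borel_measurable M"
    and \<alpha>: "\<And>n. n \<ge> 1 \<Longrightarrow> \<alpha> n \<ge> 0"
    and r: "r > 0" and K: "K \<ge> 0"
    and maximal: "\<And>m \<epsilon>. m \<ge> 1 \<Longrightarrow> \<epsilon> > 0 \<Longrightarrow>
      measure M {\<omega> \<in> space M. \<exists>l\<in>{1..m}. \<bar>S l \<omega>\<bar> \<ge> \<epsilon>} \<le> K / \<epsilon> powr r * (\<Sum>l=1..m. \<alpha> l)"
    and w_pos: "\<And>n. n \<ge> 1 \<Longrightarrow> w n > 0"
    and w_mono: "mono_on {1..} w"
    and summable: "summable (\<lambda>l. \<alpha> (l + 1) / w (l + 1) powr r)"
  shows "AE \<omega> in M. \<exists>c. \<forall>l\<ge>1. \<bar>S l \<omega>\<bar> \<le> c * w l"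
proof -
  define B where "B = (\<Sum>l. \<alpha> (l + 1) / w (l + 1) powr r)"
  define E where "E \<epsilon> m = {\<omega> \<in> space M. \<exists>l\<in>{1..m}. \<bar>S l \<omega>\<bar> \<ge> \<epsilon> * w l}" for \<epsilon> :: real and m
  have E_sets [measurable]: "E \<epsilon> m \<in> sets M" for \<epsilon> m
  proof -
    have [measurable]: "S l \<in> borel_measurable M" if "l \<in> {1..m}" for l
      using that by auto
    show ?thesis unfolding E_def by measurable
  qed
  have E_le: "measure M (E \<epsilon> m) \<le> 4 * K / \<epsilon> powr r * B" if "\<epsilon> > 0" "m \<ge> 1" for \<epsilon> m
  proof -
    have "(\<Sum>l=1..m. \<alpha> l / w l powr r) = (\<Sum>l<m. \<alpha> (l + 1) / w (l + 1) powr r)"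
      by (rule sum.reindex_bij_witness[of _ Suc "\<lambda>l. l - 1"]) auto
    also have "\<dots> \<le> B"
      unfolding B_def using summable \<alpha> by (intro sum_le_suminf) auto
    finally have "4 * K / \<epsilon> powr r * (\<Sum>l=1..m. \<alpha> l / w l powr r) \<le> 4 * K / \<epsilon> powr r * B"
      using K by (intro mult_left_mono) auto
    moreover have "measure M (E \<epsilon> m) \<le> 4 * K / \<epsilon> powr r * (\<Sum>l=1..m. \<alpha> l / w l powr r)"
      unfolding E_def using that by (intro hajek_renyi assms)
    ultimately show ?thesis by linarith
  qed
  \<comment> \<open>\<open>U n\<close> is the event that the ratio of |S l| to w l reaches n at some
    l \<ge> 1; the events \<open>E (real n) m\<close> increase to it.\<close>
  define U where "U n = (\<Union>m. E (real n) m)" for n :: nat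
  have U_le: "measure M (U n) \<le> 4 * K / real n powr r * B" if "n \<ge> 1" for n
  proof (rule LIMSEQ_le_const2)
    show "(\<lambda>m. measure M (E (real n) m)) \<longlonglongrightarrow> measure M (U n)"
      unfolding U_def
      by (intro finite_Lim_measure_incseq) (auto simp: incseq_def E_def)
    show "\<exists>k. \<forall>m\<ge>k. measure M (E (real n) m) \<le> 4 * K / real n powr r * B"
      using that by (intro exI[of _ 1] allI impI E_le) auto
  qed
  \<comment> \<open>Off Z some level n \<ge> 1 is never reached, and this n serves as the random
    constant. Level 0 is left out because \<open>U_le\<close> is available only for n \<ge>
    1.\<close>
  define Z where "Z = (\<Inter>n\<in>{1..}. U n)"
  have Z_sets: "Z \<in> sets M" unfolding Z_def U_def by measurable
  have "(\<lambda>n. 4 * K * B * real n powr (- r)) \<longlonglongrightarrow> 4 * K * B * 0"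
    using r by (intro tendsto_intros tendsto_neg_powr filterlim_real_sequentially) auto
  then have "measure M Z \<le> 4 * K * B * 0"
  proof (rule LIMSEQ_le_const)
    have "measure M Z \<le> 4 * K * B * real n powr (- r)" if "n \<ge> 1" for n
    proof -
      have "measure M Z \<le> measure M (U n)"
        using that by (intro finite_measure_mono) (auto simp: Z_def U_def)
      then show ?thesis using U_le[OF that] by (simp add: powr_minus_divide)
    qed
    then show "\<exists>k. \<forall>n\<ge>k. measure M Z \<le> 4 * K * B * real n powr (- r)" by blast
  qed
  then have "emeasure M Z = 0"
    by (simp add: emeasure_eq_measure measure_le_0_iff)
  then have "AE \<omega> in M. \<omega> \<notin> Z"
    using Z_sets by (intro AE_not_in) (auto simp: null_sets_def)
  then show ?thesis
  proof (rule AE_mp, intro AE_I2 impI)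
    fix \<omega> assume "\<omega> \<in> space M" "\<omega> \<notin> Z"
    then obtain n where "\<forall>m. \<forall>l\<in>{1..m}. \<bar>S l \<omega>\<bar> < real n * w l"
      by (auto simp: Z_def U_def E_def not_le)
    then have "\<forall>l\<ge>1. \<bar>S l \<omega>\<bar> \<le> real n * w l"
      by (meson atLeastAtMost_iff less_imp_le order_refl)
    then show "\<exists>c. \<forall>l\<ge>1. \<bar>S l \<omega>\<bar> \<le> c * w l" by blast
  qed
qed

section \<open>Series divided by powers of their tails\<close>

text \<open>The right-hand side is the integral of t^(-\<delta>) from y to x, where the integrand is
  at least x^(-\<delta>). Cleared of denominators, the claim is the weighted AM-GM inequality
  x^\<delta> y^(1-\<delta>) \<le> \<delta> x + (1-\<delta>) y, obtained from Young's
  inequality.\<close>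

lemma diff_divide_powr_le:
  fixes x y \<delta> :: real
  assumes "0 \<le> y" "y \<le> x" "0 < \<delta>" "\<delta> < 1"
  shows "(x - y) / x powr \<delta> \<le> (x powr (1 - \<delta>) - y powr (1 - \<delta>)) / (1 - \<delta>)"
proof (cases "x = 0")
  case False
  then have x: "x > 0" using assms by simp
  have "x powr \<delta> * y powr (1 - \<delta>) \<le> \<delta> * x + (1 - \<delta>) * y"
    using Youngs_inequality_0[of \<delta> "1 - \<delta>" x y] assms x
    by (cases "y = 0") simp_all
  moreover have "x powr (1 - \<delta>) * x powr \<delta> = x"
    using x by (simp add: powr_add[symmetric])
  ultimately show ?thesis
    using x assms by (simp add: field_simps)
qed (use assms in auto)

text \<open>A classical result of Dini. Each term is a difference of consecutive tails, so
  \<open>diff_divide_powr_le\<close> gives a telescoping majorant; \<delta> < 1 makes the exponent 1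
  - \<delta> positive, so the telescoping powers converge. Where the tail vanishes the quotient is
  0.\<close>

lemma summable_divide_tail_powr:
  fixes a :: "nat \<Rightarrow> real" and \<delta> :: real
  assumes nonneg: "\<And>n. a n \<ge> 0" and summable: "summable a" and \<delta>: "0 < \<delta>" "\<delta> < 1"
  shows "summable (\<lambda>n. a n / (\<Sum>l. a (l + n)) powr \<delta>)"
proof -
  define \<nu> where "\<nu> n = (\<Sum>l. a (l + n))" for n
  have sum_shift: "summable (\<lambda>l. a (l + n))" for n
    using summable by (rule summable_ignore_initial_segment)
  have \<nu>_nonneg: "\<nu> n \<ge> 0" for n
    unfolding \<nu>_def using sum_shift nonneg by (intro suminf_nonneg)
  have \<nu>_diff: "a n = \<nu> n - \<nu> (Suc n)" for n
    using suminf_split_head[OF sum_shift[of n]] by (simp add: \<nu>_def)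
  have \<nu>_lim: "\<nu> \<longlonglongrightarrow> 0"
    unfolding \<nu>_def using suminf_exist_split2[OF summable] by simp
  have "(\<lambda>n. \<nu> n powr (1 - \<delta>)) \<longlonglongrightarrow> 0 powr (1 - \<delta>)"
    using \<delta> \<nu>_nonneg by (intro tendsto_powr' \<nu>_lim tendsto_const) auto
  then have "summable (\<lambda>n. (\<nu> n powr (1 - \<delta>) - \<nu> (Suc n) powr (1 - \<delta>)) / (1 - \<delta>))"
    by (intro summable_divide telescope_summable')
  then show ?thesis
  proof (rule summable_comparison_test')
    fix n :: nat
    assume "n \<ge> 0"
    have "a n / \<nu> n powr \<delta> \<le> (\<nu> n powr (1 - \<delta>) - \<nu> (Suc n) powr (1 - \<delta>)) / (1 - \<delta>)"
      using diff_divide_powr_le[of "\<nu> (Suc n)" "\<nu> n" \<delta>] \<delta> \<nu>_nonneg[of "Suc n"]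
        \<nu>_diff[of n] nonneg[of n] by simp
    then show "norm (a n / (\<Sum>l. a (l + n)) powr \<delta>)
        \<le> (\<nu> n powr (1 - \<delta>) - \<nu> (Suc n) powr (1 - \<delta>)) / (1 - \<delta>)"
      using nonneg[of n] by (simp add: \<nu>_def)
  qed
qed

section \<open>The weight \<beta> and its growth relative to b\<close>

lemma max_beta_ge:
  assumes "1 \<le> k" "k \<le> n"
  shows "b k * tail_nu \<alpha> b r k powr (\<delta> / r) \<le> max_beta \<alpha> b r \<delta> n"
  unfolding max_beta_def using assms by (intro Max_ge) auto

lemma max_beta_mono: "mono_on {1..} (max_beta \<alpha> b r \<delta>)"
  unfolding max_beta_def by (intro mono_onI Max_mono) auto

text \<open>The maximum splits at a fixed index. The early terms are bounded by a constant, which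
  the unbounded b n outgrows; for the late terms b k \<le> b n and the power of the tail is below
  e.\<close>

lemma max_beta_divide_tendsto_0:
  fixes \<alpha> b :: "nat \<Rightarrow> real" and r \<delta> :: real
  assumes \<alpha>: "\<And>n. n \<ge> 1 \<Longrightarrow> \<alpha> n \<ge> 0"
    and r: "r > 0" and \<delta>: "\<delta> > 0"
    and b_pos: "\<And>n. n \<ge> 1 \<Longrightarrow> b n > 0"
    and b_mono: "mono_on {1..} b"
    and b_unbdd: "\<not> bdd_above (b ` {1..})"
    and summable: "summable (\<lambda>l. \<alpha> (l + 1) / b (l + 1) powr r)"
  shows "(\<lambda>n. max_beta \<alpha> b r \<delta> n / b n) \<longlonglongrightarrow> 0"
proof (rule LIMSEQ_I)
  fix e :: real
  assume e: "e > 0"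
  define g where "g k = tail_nu \<alpha> b r k powr (\<delta> / r)" for k
  have "(\<lambda>n. tail_nu \<alpha> b r (Suc n)) \<longlonglongrightarrow> 0"
    using suminf_exist_split2[OF summable] by (simp add: tail_nu_def)
  moreover have nu_nonneg: "tail_nu \<alpha> b r (Suc n) \<ge> 0" for n
    unfolding tail_nu_def
    using summable_ignore_initial_segment[OF summable, of n] \<alpha> by (intro suminf_nonneg) auto
  ultimately have "(\<lambda>n. g (Suc n)) \<longlonglongrightarrow> 0 powr (\<delta> / r)"
    unfolding g_def using r \<delta> by (intro tendsto_powr' tendsto_const) auto
  then have "\<forall>\<^sub>F n in sequentially. g (Suc n) < e"
    using e by (intro order_tendstoD) auto
  then obtain N where N: "\<And>n. n \<ge> N \<Longrightarrow> g (Suc n) < e"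
    by (auto simp: eventually_sequentially)
  \<comment> \<open>C bounds all terms with k \<le> N + 1; \<open>n0\<close> is chosen so that e * b
    n exceeds C from there on, and n0 \<ge> 1 keeps the range of the maximum nonempty.\<close>
  define C where "C = max_beta \<alpha> b r \<delta> (Suc N)"
  obtain n0 where n0: "n0 \<ge> 1" "b n0 > C / e"
    using b_unbdd by (auto simp: bdd_above_def not_le)
  have "norm (max_beta \<alpha> b r \<delta> n / b n - 0) < e" if n: "n \<ge> n0" for n
  proof -
    have bn: "b n > 0" using n n0 b_pos[of n] by simp
    have "b n0 \<le> b n" using mono_onD[OF b_mono, of n0 n] n n0 by auto
    then have "C / e < b n" using n0 by linarith
    then have C: "C < e * b n" using e by (simp add: divide_less_eq mult.commute)
    have "b k * g k < e * b n" if k: "1 \<le> k" "k \<le> n" for k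
    proof (cases "k \<le> Suc N")
      case True
      then have "b k * g k \<le> C"
        unfolding C_def g_def using k by (intro max_beta_ge) auto
      then show ?thesis using C by linarith
    next
      case False
      have "b k * g k < b k * e"
        using N[of "k - 1"] False k b_pos[of k] by (intro mult_strict_left_mono) auto
      also have "\<dots> \<le> b n * e"
        using mono_onD[OF b_mono, of k n] k e by (intro mult_right_mono) auto
      finally show ?thesis by (simp add: mult.commute)
    qed
    then have "max_beta \<alpha> b r \<delta> n < e * b n"
      unfolding max_beta_def g_def using n n0 by (subst Max_less_iff) auto
    moreover have "0 \<le> max_beta \<alpha> b r \<delta> n"
      using b_pos[of 1] n n0
      by (intro order_trans[OF _ max_beta_ge[of 1]]) auto
    ultimately show ?thesis using bn by (simp add: divide_less_eq)
  qed
  then show "\<exists>n0. \<forall>n\<ge>n0. norm (max_beta \<alpha> b r \<delta> n / b n - 0) < e" by blast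
qed

section \<open>The degenerate case, and the limit from the rate\<close>

text \<open>Covers the case in which all \<alpha> l vanish: then \<beta> is identically 0 and cannot
  serve as a positive weight in \<open>AE_bounded_ratio\<close>. The levels 1/(k+1) reduce the claim
  to countably many null events.\<close>

lemma (in finite_measure) AE_eq_0:
  fixes S :: "nat \<Rightarrow> 'a \<Rightarrow> real"
  assumes S [measurable]: "\<And>n. n \<ge> 1 \<Longrightarrow> S n \<in> borel_measurable M"
    and null: "\<And>m \<epsilon>. m \<ge> 1 \<Longrightarrow> \<epsilon> > 0 \<Longrightarrow>
      measure M {\<omega> \<in> space M. \<exists>l\<in>{1..m}. \<bar>S l \<omega>\<bar> \<ge> \<epsilon>} \<le> 0"
  shows "AE \<omega> in M. \<forall>l\<ge>1. S l \<omega> = 0"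
proof -
  have "AE \<omega> in M. \<bar>S l \<omega>\<bar> < inverse (real (Suc k))" if l: "l \<ge> 1" for l k
  proof -
    define A where "A = {\<omega> \<in> space M. \<exists>i\<in>{1..l}. \<bar>S i \<omega>\<bar> \<ge> inverse (real (Suc k))}"
    have [measurable]: "S i \<in> borel_measurable M" if "i \<in> {1..l}" for i
      using that by auto
    have "A \<in> sets M" unfolding A_def by measurable
    moreover have "emeasure M A = 0"
      using null[OF l, of "inverse (real (Suc k))"]
      by (simp add: A_def emeasure_eq_measure measure_le_0_iff)
    ultimately have "AE \<omega> in M. \<omega> \<notin> A"
      by (intro AE_not_in) (auto simp: null_sets_def)
    then show ?thesis
      by (rule AE_mp, intro AE_I2) (use l in \<open>auto simp: A_def not_le\<close>)
  qed
  then have "AE \<omega> in M. \<forall>l. l \<ge> 1 \<longrightarrow> (\<forall>k. \<bar>S l \<omega>\<bar> < inverse (real (Suc k)))"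
    by (subst AE_all_countable, intro allI) (auto simp: AE_all_countable)
  then show ?thesis
  proof (rule AE_mp, intro AE_I2 impI allI)
    fix \<omega> l
    assume "\<forall>l. l \<ge> 1 \<longrightarrow> (\<forall>k. \<bar>S l \<omega>\<bar> < inverse (real (Suc k)))" and "l \<ge> (1::nat)"
    then show "S l \<omega> = 0"
      using reals_Archimedean[of "\<bar>S l \<omega>\<bar>"] by (metis less_asym zero_less_abs_iff)
  qed
qed

lemma as_bigo_imp_tendsto_0:
  assumes "as_bigo M f g" and "g \<longlonglongrightarrow> 0"
  shows "AE \<omega> in M. (\<lambda>n. f n \<omega>) \<longlonglongrightarrow> 0"
  using assms(1) unfolding as_bigo_def
proof (rule AE_mp, intro AE_I2 impI)
  fix \<omega>
  assume "\<exists>c. \<forall>\<^sub>F n in sequentially. \<bar>f n \<omega>\<bar> \<le> c * g n"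
  then obtain c where "\<forall>\<^sub>F n in sequentially. norm (f n \<omega>) \<le> c * g n" by auto
  moreover have "(\<lambda>n. c * g n) \<longlonglongrightarrow> 0"
    using tendsto_mult_left[OF assms(2), of c] by simp
  ultimately show "(\<lambda>n. f n \<omega>) \<longlonglongrightarrow> 0"
    by (rule Lim_null_comparison)
qed

section \<open>Almost sure rate and strong law\<close>

theorem theorem5p1:
  fixes M :: "'a measure"
    and X :: "nat \<Rightarrow> 'a \<Rightarrow> real"
    and \<alpha> b :: "nat \<Rightarrow> real"
    and r K :: real
  assumes "prob_space M"
    and "\<And>n. n \<ge> 1 \<Longrightarrow> X n \<in> borel_measurable M"
    and "\<And>n. n \<ge> 1 \<Longrightarrow> \<alpha> n \<ge> 0"
    and "r > 0"
    and "K > 0"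
    and "\<And>m \<epsilon>. m \<ge> 1 \<Longrightarrow> \<epsilon> > 0 \<Longrightarrow>
      measure M {\<omega> \<in> space M. Max ((\<lambda>l. \<bar>partial_sum X l \<omega>\<bar>) ` {1..m}) \<ge> \<epsilon>}
        \<le> K / \<epsilon> powr r * (\<Sum>l=1..m. \<alpha> l)"
    and "\<And>n. n \<ge> 1 \<Longrightarrow> b n > 0"
    and "mono_on {1..} b"
    and "\<not> bdd_above (b ` {1..})"
    and "summable (\<lambda>l. \<alpha> (l + 1) / b (l + 1) powr r)"
  shows "(AE \<omega> in M. (\<lambda>n. partial_sum X n \<omega> / b n) \<longlonglongrightarrow> 0) \<and>
    (\<forall>\<delta>. 0 < \<delta> \<and> \<delta> < 1 \<longrightarrow>
      as_bigo M (\<lambda>n \<omega>. partial_sum X n \<omega> / b n) (\<lambda>n. max_beta \<alpha> b r \<delta> n / b n))"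
proof -
  interpret prob_space M by fact
  note \<alpha> = assms(3) and r = assms(4) and K = assms(5) and b_pos = assms(7)
    and b_mono = assms(8) and summable = assms(10)
  let ?S = "partial_sum X" and ?\<nu> = "tail_nu \<alpha> b r"
  have S: "?S n \<in> borel_measurable M" for n
  proof -
    have "(\<lambda>\<omega>. \<Sum>i=1..n. X i \<omega>) \<in> borel_measurable M"
      using assms(2) by (intro borel_measurable_sum) auto
    then show ?thesis by (simp add: partial_sum_def[abs_def])
  qed
  have maximal: "measure M {\<omega> \<in> space M. \<exists>l\<in>{1..m}. \<bar>?S l \<omega>\<bar> \<ge> \<epsilon>}
      \<le> K / \<epsilon> powr r * (\<Sum>l=1..m. \<alpha> l)" if "m \<ge> 1" "\<epsilon> > 0" for m \<epsilon>
  proof -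
    have "{\<omega> \<in> space M. \<exists>l\<in>{1..m}. \<bar>?S l \<omega>\<bar> \<ge> \<epsilon>}
        = {\<omega> \<in> space M. Max ((\<lambda>l. \<bar>?S l \<omega>\<bar>) ` {1..m}) \<ge> \<epsilon>}"
      using that by (subst Max_ge_iff) auto
    then show ?thesis using assms(6)[OF that] by simp
  qed
  have nu_Suc: "?\<nu> (Suc n) = (\<Sum>l. \<alpha> (l + n + 1) / b (l + n + 1) powr r)" for n
    by (simp add: tail_nu_def)
  have term_nonneg: "\<alpha> (n + 1) / b (n + 1) powr r \<ge> 0" for n
    using \<alpha> by simp
  have term_le_nu: "\<alpha> (n + 1) / b (n + 1) powr r \<le> ?\<nu> (Suc n)" for n
    using sum_le_suminf[OF summable_ignore_initial_segment[OF summable, of n], of "{0}"] \<alpha>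
    by (simp add: nu_Suc)
  have bigo: "as_bigo M (\<lambda>n \<omega>. ?S n \<omega> / b n) (\<lambda>n. max_beta \<alpha> b r \<delta> n / b n)"
    if \<delta>: "0 < \<delta>" "\<delta> < 1" for \<delta>
  proof -
    let ?\<beta> = "max_beta \<alpha> b r \<delta>"
    have "AE \<omega> in M. \<exists>c. \<forall>l\<ge>1. \<bar>?S l \<omega>\<bar> \<le> c * ?\<beta> l"
    \<comment> \<open>A vanishing first tail forces every \<alpha> l to be 0, so the partial sums
      vanish almost surely and c = 0 works.\<close>
    proof (cases "?\<nu> 1 = 0")
      case True
      have "\<alpha> l = 0" if "l \<ge> 1" for l
      proof -
        have "\<alpha> (l - 1 + 1) / b (l - 1 + 1) powr r = 0"
          using True summable term_nonneg suminf_eq_zero_iff[OF summable]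
          by (auto simp: tail_nu_def)
        then show ?thesis using that b_pos[OF that] by simp
      qed
      then have "measure M {\<omega> \<in> space M. \<exists>l\<in>{1..m}. \<bar>?S l \<omega>\<bar> \<ge> \<epsilon>} \<le> 0"
        if "m \<ge> 1" "\<epsilon> > 0" for m \<epsilon>
        using maximal[OF that] by simp
      then have "AE \<omega> in M. \<forall>l\<ge>1. ?S l \<omega> = 0"
        using S by (intro AE_eq_0)
      then show ?thesis
        by (rule AE_mp, intro AE_I2 impI exI[of _ 0]) auto
    next
      case False
      have "?\<nu> 1 \<ge> 0" using term_le_nu[of 0] term_nonneg[of 0] by simp
      \<comment> \<open>The term k = 1 alone keeps every \<beta> n positive, even if later tails
        vanish.\<close>
      then have "b 1 * ?\<nu> 1 powr (\<delta> / r) > 0" using False b_pos[of 1] by simp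
      then have \<beta>_pos: "?\<beta> n > 0" if "n \<ge> 1" for n
        using max_beta_ge[of 1 n b \<alpha> r \<delta>] that by simp
      have "summable (\<lambda>n. \<alpha> (n + 1) / b (n + 1) powr r / ?\<nu> (Suc n) powr \<delta>)"
        unfolding nu_Suc using summable_divide_tail_powr[OF term_nonneg summable \<delta>] .
      then have "summable (\<lambda>n. \<alpha> (n + 1) / ?\<beta> (n + 1) powr r)"
      proof (rule summable_comparison_test')
        fix n :: nat
        assume "n \<ge> 0"
        show "norm (\<alpha> (n + 1) / ?\<beta> (n + 1) powr r)
            \<le> \<alpha> (n + 1) / b (n + 1) powr r / ?\<nu> (Suc n) powr \<delta>"
        \<comment> \<open>A nonzero \<alpha> (n + 1) makes the tail starting at it positive, so the
          division is genuine; otherwise both sides are 0.\<close>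
        proof (cases "\<alpha> (n + 1) = 0")
          case False
          then have "\<alpha> (n + 1) > 0" using \<alpha>[of "n + 1"] by simp
          then have nu_pos: "?\<nu> (Suc n) > 0"
            using b_pos[of "n + 1"]
            by (intro less_le_trans[OF _ term_le_nu[of n]]) simp
          \<comment> \<open>The exponent \<delta> / r in \<beta> is what yields the power \<delta>
            of the tail here, matching the series of
            \<open>summable_divide_tail_powr\<close>.\<close>
          have "b (n + 1) powr r * ?\<nu> (Suc n) powr \<delta>
              = (b (n + 1) * ?\<nu> (n + 1) powr (\<delta> / r)) powr r"
            using nu_pos b_pos[of "n + 1"] r by (simp add: powr_mult powr_powr)
          also have "\<dots> \<le> ?\<beta> (n + 1) powr r"
            using b_pos[of "n + 1"] r by (intro powr_mono2 max_beta_ge) auto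
          finally have "\<alpha> (n + 1) / ?\<beta> (n + 1) powr r
              \<le> \<alpha> (n + 1) / (b (n + 1) powr r * ?\<nu> (Suc n) powr \<delta>)"
            using \<alpha>[of "n + 1"] b_pos[of "n + 1"] nu_pos \<beta>_pos[of "n + 1"]
            by (intro divide_left_mono mult_pos_pos) auto
          then show ?thesis using \<alpha>[of "n + 1"] by simp
        qed simp
      qed
      then show ?thesis
        using S \<alpha> r less_imp_le[OF K] maximal \<beta>_pos max_beta_mono
        by (intro AE_bounded_ratio[where K = K])
    qed
    then show ?thesis
      unfolding as_bigo_def
    proof (rule AE_mp, intro AE_I2 impI)
      fix \<omega>
      assume "\<exists>c. \<forall>l\<ge>1. \<bar>?S l \<omega>\<bar> \<le> c * ?\<beta> l"
      then obtain c where c: "\<And>l. l \<ge> 1 \<Longrightarrow> \<bar>?S l \<omega>\<bar> \<le> c * ?\<beta> l" by blast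
      have "\<bar>?S n \<omega> / b n\<bar> \<le> c * (?\<beta> n / b n)" if "n \<ge> 1" for n
        using c[OF that] b_pos[OF that] by (simp add: abs_divide divide_right_mono)
      then show "\<exists>c. \<forall>\<^sub>F n in sequentially. \<bar>?S n \<omega> / b n\<bar> \<le> c * (?\<beta> n / b n)"
        by (auto simp: eventually_sequentially)
    qed
  qed
  \<comment> \<open>Any \<delta> strictly between 0 and 1 would do here; 1/2 is an arbitrary
    choice.\<close>
  have "(\<lambda>n. max_beta \<alpha> b r (1 / 2) n / b n) \<longlonglongrightarrow> 0"
    using assms by (intro max_beta_divide_tendsto_0) auto
  then have "AE \<omega> in M. (\<lambda>n. ?S n \<omega> / b n) \<longlonglongrightarrow> 0"
    using bigo[of "1 / 2"] by (intro as_bigo_imp_tendsto_0) auto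
  then show ?thesis using bigo by blast
qed

end
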